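(* Let $\alpha>0$ and let $\mathbf m=\{m_j\}_{j\ge1}$ be a sequence of positive integers satisfying $m_j=j^{\alpha+o(1)}$ as $j\to\infty$. Let $M\ge 0$, $N\ge1$, $Q\ge1$ be integers with $Q^{\alpha}\le N\le Q^{2\alpha}$, and let $(a_n)_{n=M+1}^{M+N}$ be complex numbers. Then $$\sum_{j=1}^{Q}\ \sum_{\substack{b=1\\ \gcd(b,m_j)=1}}^{m_j}\left|\sum_{n=M+1}^{M+N}a_n\, e\!\left(\frac{b n}{m_j}\right)\right|^2\le \left(N\,\mathsf E^+(\mathbf m_Q)^{1/4}+N^{3/4}Q^{\alpha/2}\,\mathsf E^+_{\star}(\mathbf m_Q)^{1/4}\right)Q^{o(1)}\sum_{n=M+1}^{M+N}|a_n|^2,$$ where $Q^{o(1)}$ is a factor which, for every $\varepsilon>0$, is at most $Q^{\varepsilon}$ once $Q$ is sufficiently large (in terms of $\varepsilon$, $\alpha$ and the sequence $\mathbf m$), uniformly in $M$, $N$ and $(a_n)$.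
   Context: $e(z)=\exp(2\pi i z)$. For a finite set $\mathcal S\subseteq\mathbb R$, the additive energy is $\mathsf E^+(\mathcal S)=\#\{(s_1,t_1,s_2,t_2)\in\mathcal S^4: s_1+t_1=s_2+t_2\}$; for $h\in\mathbb Z$, $\mathsf E^+_h(\mathcal S)=\#\{(s_1,t_1,s_2,t_2)\in\mathcal S^4: s_1+t_1=s_2+t_2+h\}$; and $\mathsf E^+_\star(\mathcal S)=\max_{h\ne0}\mathsf E^+_h(\mathcal S)$. $\mathbf m_Q=\{m_1,\dots,m_Q\}$ denotes the set of the first $Q$ terms of $\mathbf m$.
   Formalization: With repeated terms the inequality with energies of the set m_Q is false (e.g. m_j=2^⌊log2 j⌋, α=1, N=Q²); it is proved for Q whenever m_1,…,m_Q are distinct, and for all sequences with the energies counting indices (terms with multiplicity). *)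

theory Defs
  imports "HOL-Analysis.Analysis"
begin

definition add_char :: "complex \<Rightarrow> complex" where
  "add_char z = exp (2 * of_real pi * \<i> * z)"

definition energy :: "real set \<Rightarrow> nat" where
  "energy S = card {(s1, t1, s2, t2). s1 \<in> S \<and> t1 \<in> S \<and> s2 \<in> S \<and> t2 \<in> S \<and>
     s1 + t1 = s2 + t2}"

definition energy_shift :: "int \<Rightarrow> real set \<Rightarrow> nat" where
  "energy_shift h S = card {(s1, t1, s2, t2). s1 \<in> S \<and> t1 \<in> S \<and> s2 \<in> S \<and> t2 \<in> S \<and>
     s1 + t1 = s2 + t2 + of_int h}"

text \<open>For finite \<open>S\<close> the shifted energies are at most \<open>card S ^ 4\<close>, so the maximum below is taken
  over a finite nonempty set of natural numbers, although \<open>h\<close> ranges over infinitely many integers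
  (see \<open>finite_energy_shifts\<close>).\<close>

definition energy_star :: "real set \<Rightarrow> nat" where
  "energy_star S = Max {energy_shift h S | h. h \<noteq> 0}"

text \<open>The same quantities for a finite family \<open>(f i)\<close>, \<open>i \<in> I\<close>, whose members are counted with
  multiplicity, i.e. the quadruples consist of indices. They agree with the energies of the set
  \<open>f ` I\<close> when the members are distinct.
  For moduli with repetitions they are the right notion: the sum over \<open>j\<close> in \<open>sieve_sum\<close> counts
  repeated moduli, and the inequality fails with the energies of the bare set of values.\<close>

definition fam_energy :: "('i \<Rightarrow> real) \<Rightarrow> 'i set \<Rightarrow> nat" where
  "fam_energy f I = card {(i1, j1, i2, j2). i1 \<in> I \<and> j1 \<in> I \<and> i2 \<in> I \<and> j2 \<in> I \<and>
     f i1 + f j1 = f i2 + f j2}"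

definition fam_energy_shift :: "int \<Rightarrow> ('i \<Rightarrow> real) \<Rightarrow> 'i set \<Rightarrow> nat" where
  "fam_energy_shift h f I = card {(i1, j1, i2, j2). i1 \<in> I \<and> j1 \<in> I \<and> i2 \<in> I \<and> j2 \<in> I \<and>
     f i1 + f j1 = f i2 + f j2 + of_int h}"

definition fam_energy_star :: "('i \<Rightarrow> real) \<Rightarrow> 'i set \<Rightarrow> nat" where
  "fam_energy_star f I = Max {fam_energy_shift h f I | h. h \<noteq> 0}"

lemma fam_energy_shift_le:
  assumes "finite I"
  shows "fam_energy_shift h f I \<le> card I ^ 4"
proof -
  have "fam_energy_shift h f I \<le> card (I \<times> I \<times> I \<times> I)"
    unfolding fam_energy_shift_def by (rule card_mono) (use assms in auto)
  then show ?thesis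
    by (simp add: card_cartesian_product power4_eq_xxxx mult.assoc)
qed

lemma finite_fam_energy_shifts:
  assumes "finite I"
  shows "finite {fam_energy_shift h f I | h. h \<noteq> 0}"
  by (rule finite_subset[of _ "{..card I ^ 4}"]) (use fam_energy_shift_le[OF assms] in auto)

lemma fam_energy_shift_eq:
  assumes "inj_on f I"
  shows "fam_energy_shift h f I = energy_shift h (f ` I)"
proof -
  let ?F = "\<lambda>(i1, j1, i2, j2). (f i1, f j1, f i2, f j2)"
  let ?A = "{(i1, j1, i2, j2). i1 \<in> I \<and> j1 \<in> I \<and> i2 \<in> I \<and> j2 \<in> I \<and>
     f i1 + f j1 = f i2 + f j2 + of_int h}"
  let ?B = "{(s1, t1, s2, t2). s1 \<in> f ` I \<and> t1 \<in> f ` I \<and> s2 \<in> f ` I \<and> t2 \<in> f ` I \<and>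
     s1 + t1 = s2 + t2 + of_int h}"
  have inj: "inj_on ?F ?A"
    by (rule inj_onI) (clarsimp simp: inj_on_eq_iff[OF assms])
  have "?F ` ?A = ?B"
  proof
    show "?F ` ?A \<subseteq> ?B" by clarsimp
    show "?B \<subseteq> ?F ` ?A"
    proof clarify
      fix i1 j1 i2 j2
      assume "i1 \<in> I" "j1 \<in> I" "i2 \<in> I" "j2 \<in> I" "f i1 + f j1 = f i2 + f j2 + of_int h"
      then show "(f i1, f j1, f i2, f j2) \<in> ?F ` ?A"
        by (intro image_eqI[of _ _ "(i1, j1, i2, j2)"]) simp_all
    qed
  qed
  then have "card ?B = card ?A"
    using card_image[OF inj] by simp
  then show ?thesis
    unfolding fam_energy_shift_def energy_shift_def by simp
qed

lemma fam_energy_eq: "inj_on f I \<Longrightarrow> fam_energy f I = energy (f ` I)"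
  using fam_energy_shift_eq[of f I 0]
  by (simp add: fam_energy_shift_def energy_shift_def fam_energy_def energy_def)

lemma fam_energy_star_eq: "inj_on f I \<Longrightarrow> fam_energy_star f I = energy_star (f ` I)"
  by (simp add: fam_energy_star_def energy_star_def fam_energy_shift_eq)

lemma finite_energy_shifts:
  assumes "finite S"
  shows "finite {energy_shift h S | h. h \<noteq> 0}"
  using finite_fam_energy_shifts[OF assms, of "\<lambda>x. x"] fam_energy_shift_eq[of "\<lambda>x. x" S]
  by simp

text \<open>The left-hand side of the large sieve inequality for the moduli \<open>m 1, \<dots>, m Q\<close>.\<close>

definition sieve_sum :: "(nat \<Rightarrow> nat) \<Rightarrow> nat \<Rightarrow> nat \<Rightarrow> nat \<Rightarrow> (nat \<Rightarrow> complex) \<Rightarrow> real" where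
  "sieve_sum m Q M N a = (\<Sum>j=1..Q. \<Sum>b | b \<in> {1..m j} \<and> coprime b (m j).
     (cmod (\<Sum>n=M+1..M+N. a n * add_char (of_nat b * of_nat n / of_nat (m j))))\<^sup>2)"

end

theory Submission imports Defs begin

text \<open>The large sieve, in its dual form with a Fejer-type weight, bounds the sum over points
  \<open>x k\<close> by \<open>16 N K \<Sum>\<bar>a n\<bar>\<^sup>2\<close>, where \<open>K\<close> is the largest number of points within \<open>1/N\<close> modulo 1
  of one of them. Splitting the moduli into boundedly many blocks, one may assume
  \<open>T \<le> m j \<le> U\<close> with \<open>U/T\<close> at most a small power of \<open>Q\<close>. If \<open>b/m j\<close> is close to \<open>x = b0/m j0\<close>,
  then \<open>m j x\<close> is within \<open>U/N\<close> of an integer. For four such \<open>j\<close> the difference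
  \<open>h = m i1 + m j1 - m i2 - m j2\<close> satisfies \<open>\<bar>h\<bar> \<le> 2 U\<close>, and \<open>h x\<close> is within \<open>4 U/N\<close> of an
  integer; since \<open>b0\<close> is invertible modulo \<open>m j0 \<ge> T\<close>, there are at most about \<open>U\<^sup>2/N \<cdot> U/T\<close>
  such \<open>h\<close>. Hence the fourth power of the number of admissible \<open>j\<close> is at most the energy
  plus this count times the maximal shifted energy.\<close>

section \<open>Bounds for the Dirichlet kernel\<close>

definition dirichlet_kernel :: "nat \<Rightarrow> real \<Rightarrow> complex" where
  "dirichlet_kernel L x = (\<Sum>u<L. cis (2 * pi * real u * x))"

lemma norm_dirichlet_kernel_le: "norm (dirichlet_kernel L x) \<le> real L"
proof -
  have "norm (dirichlet_kernel L x) \<le> (\<Sum>u<L. norm (cis (2 * pi * real u * x)))"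
    unfolding dirichlet_kernel_def by (rule norm_sum)
  then show ?thesis by simp
qed

text \<open>Jordan's inequality: sine is concave on \<open>[0, pi/2]\<close>, so its graph there
  lies above the chord joining the endpoints.\<close>

lemma abs_sin_pi_ge:
  assumes "\<bar>s\<bar> \<le> 1/2"
  shows "2 * \<bar>s\<bar> \<le> \<bar>sin (pi * s)\<bar>"
proof -
  define t where "t = 2 * \<bar>s\<bar>"
  have t: "0 \<le> t" "t \<le> 1" using assms by (auto simp: t_def)
  have "convex_on {0..pi/2} (\<lambda>x. - sin x)"
    by (rule f''_ge0_imp_convex[where f' = "\<lambda>x. - cos x" and f'' = sin])
       (auto intro!: derivative_eq_intros sin_ge_zero)
  from convex_onD[OF this, of t 0 "pi/2"] t
  have "t \<le> sin (t * (pi/2))" by simp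
  also have "sin (t * (pi/2)) = sin (pi * \<bar>s\<bar>)" by (simp add: t_def mult.commute)
  also have "\<dots> \<le> \<bar>sin (pi * s)\<bar>" by (cases "s \<ge> 0") auto
  finally show ?thesis by (simp add: t_def)
qed

text \<open>The kernel is a geometric sum, so multiplying it by \<open>w - 1\<close> gives
  \<open>w ^ L - 1\<close>, of norm at most 2, whereas \<open>w - 1\<close> has norm at least
  \<open>4 * \<bar>x - z\<bar>\<close>. The product form also covers \<open>x = z\<close>.\<close>

lemma norm_dirichlet_kernel_mult_le:
  fixes x :: real and z :: int
  assumes "\<bar>x - z\<bar> \<le> 1/2"
  shows "norm (dirichlet_kernel L x) * (2 * \<bar>x - z\<bar>) \<le> 1"
proof -
  define w where "w = cis (2 * pi * x)"
  have w: "w = cis (2 * pi * (x - z))"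
  proof -
    have "cis (2 * pi * x) = cis (2 * pi * (x - z)) * cis (2 * pi * of_int z)"
      by (simp add: cis_mult algebra_simps)
    also have "cis (2 * pi * of_int z) = 1" by (rule cis_multiple_2pi) simp
    finally show ?thesis by (simp add: w_def)
  qed
  have D: "dirichlet_kernel L x = (\<Sum>u<L. w ^ u)"
    unfolding dirichlet_kernel_def w_def by (simp add: Complex.DeMoivre mult_ac)
  have "norm (w - 1) = 2 * \<bar>sin (pi * (x - z))\<bar>"
    unfolding w cis_conv_exp by (subst dist_exp_i_1) simp
  then have "4 * \<bar>x - z\<bar> \<le> norm (w - 1)"
    using abs_sin_pi_ge[OF assms] by linarith
  then have "norm (dirichlet_kernel L x) * (4 * \<bar>x - z\<bar>) \<le> norm (dirichlet_kernel L x) * norm (w - 1)"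
    by (intro mult_left_mono) auto
  also have "\<dots> = norm (w ^ L - 1)"
    unfolding D power_diff_1_eq by (simp add: norm_mult)
  also have "\<dots> \<le> norm (w ^ L) + norm (1::complex)" by (rule norm_triangle_ineq4)
  also have "\<dots> = 2" by (simp add: norm_power w_def)
  finally show ?thesis by simp
qed

section \<open>The large sieve in dual form\<close>

text \<open>Every \<open>n\<close> in the window equals \<open>M + u - v\<close> with
  \<open>u = n - M + v\<close>, once for each \<open>v < N\<close>, and then \<open>u < 2*N\<close>.
  Positivity allows enlarging the range to all \<open>u, v < 2*N\<close>, where the double sum
  factors into a squared kernel; this is the Fejer-type weight.\<close>

lemma sum_norm_sq_window_le:
  fixes A :: "'k \<Rightarrow> complex" and x :: "'k \<Rightarrow> real"
  assumes "finite P"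
  shows "real N * (\<Sum>n=M+1..M+N. (norm (\<Sum>k\<in>P. A k * cis (2 * pi * real n * x k)))\<^sup>2)
    \<le> (\<Sum>k\<in>P. \<Sum>l\<in>P. norm (A k) * norm (A l) * (norm (dirichlet_kernel (2*N) (x k - x l)))\<^sup>2)"
proof -
  define B where "B = (\<lambda>y. \<Sum>k\<in>P. A k * cis (2 * pi * y * x k))"
  define D where "D = dirichlet_kernel (2*N)"
  let ?g = "\<lambda>(n, v). (n - M + v, v)" and ?S = "{M+1..M+N} \<times> {..<N}"
  have "real N * (\<Sum>n=M+1..M+N. (norm (B (real n)))\<^sup>2)
      = (\<Sum>(n,v)\<in>?S. (norm (B (real n)))\<^sup>2)"
    by (simp add: sum.cartesian_product[symmetric] sum_distrib_left)
  also have "\<dots> = (\<Sum>(n,v)\<in>?S. (norm (B (real M + real (n - M + v) - real v)))\<^sup>2)"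
    by (rule sum.cong) (auto simp: of_nat_diff)
  also have "\<dots> = (\<Sum>(u,v)\<in>?g ` ?S. (norm (B (real M + real u - real v)))\<^sup>2)"
    by (subst sum.reindex) (auto simp: inj_on_def case_prod_unfold)
  also have "\<dots> \<le> (\<Sum>(u,v)\<in>{..<2*N} \<times> {..<2*N}. (norm (B (real M + real u - real v)))\<^sup>2)"
    by (rule sum_mono2) auto
  also have "\<dots> = (\<Sum>u<2*N. \<Sum>v<2*N. (norm (B (real M + real u - real v)))\<^sup>2)"
    by (simp add: sum.cartesian_product)
  also have "\<dots> \<le> norm (complex_of_real (\<Sum>u<2*N. \<Sum>v<2*N. (norm (B (real M + real u - real v)))\<^sup>2))"
    by (simp only: norm_of_real)
  also have "complex_of_real (\<Sum>u<2*N. \<Sum>v<2*N. (norm (B (real M + real u - real v)))\<^sup>2)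
      = (\<Sum>u<2*N. \<Sum>v<2*N. \<Sum>k\<in>P. \<Sum>l\<in>P. A k * cnj (A l) *
          cis (2 * pi * real M * (x k - x l)) *
          (cis (2 * pi * real u * (x k - x l)) * cnj (cis (2 * pi * real v * (x k - x l)))))"
    unfolding of_real_sum complex_norm_square B_def
    by (simp add: sum_product cis_cnj cis_mult mult_ac)
       (intro sum.cong refl, simp add: cis_mult algebra_simps)
  \<comment> \<open>With \<open>k\<close> and \<open>l\<close> outermost, the inner sums over
    \<open>u\<close> and \<open>v\<close> separate into a kernel and its conjugate.\<close>
  also have "\<dots> = (\<Sum>k\<in>P. \<Sum>l\<in>P. \<Sum>u<2*N. \<Sum>v<2*N. A k * cnj (A l) *
          cis (2 * pi * real M * (x k - x l)) *
          (cis (2 * pi * real u * (x k - x l)) * cnj (cis (2 * pi * real v * (x k - x l)))))"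
    by (subst (2) sum.swap, subst (3) sum.swap, subst (1) sum.swap, subst (2) sum.swap) simp
  also have "\<dots> = (\<Sum>k\<in>P. \<Sum>l\<in>P. A k * cnj (A l) *
          cis (2 * pi * real M * (x k - x l)) * (D (x k - x l) * cnj (D (x k - x l))))"
    unfolding D_def dirichlet_kernel_def cnj_sum sum_product by (simp add: sum_distrib_left)
  also have "norm \<dots> \<le> (\<Sum>k\<in>P. \<Sum>l\<in>P. norm (A k) * norm (A l) * (norm (D (x k - x l)))\<^sup>2)"
    by (intro order.trans[OF norm_sum] sum_mono)
       (simp add: norm_mult power2_eq_square)
  finally show ?thesis by (simp add: B_def D_def)
qed

text \<open>Duality: \<open>A k\<close> is the value of the trigonometric polynomial at \<open>x k\<close>, and the sum of
  \<open>(norm (A k))\<^sup>2\<close> is the pairing of \<open>a\<close> with the dual polynomial with coefficients \<open>cnj (A k)\<close>.\<close>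

lemma large_sieve_kernel:
  fixes a :: "nat \<Rightarrow> complex" and x :: "'k \<Rightarrow> real"
  assumes P: "finite P" and N: "N \<ge> 1" and B: "B \<ge> 0"
    and K: "\<And>k. k \<in> P \<Longrightarrow> (\<Sum>l\<in>P. (norm (dirichlet_kernel (2*N) (x k - x l)))\<^sup>2) \<le> B"
    and K': "\<And>k. k \<in> P \<Longrightarrow> (\<Sum>l\<in>P. (norm (dirichlet_kernel (2*N) (x l - x k)))\<^sup>2) \<le> B"
  shows "real N * (\<Sum>k\<in>P. (norm (\<Sum>n=M+1..M+N. a n * cis (2 * pi * real n * x k)))\<^sup>2)
     \<le> B * (\<Sum>n=M+1..M+N. (norm (a n))\<^sup>2)"
proof -
  define A where "A = (\<lambda>k. \<Sum>n=M+1..M+N. a n * cis (2 * pi * real n * x k))"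
  define D where "D = (\<lambda>k l. (norm (dirichlet_kernel (2*N) (x k - x l)))\<^sup>2)"
  define T where "T = (\<Sum>k\<in>P. (norm (A k))\<^sup>2)"
  define Z where "Z = (\<Sum>n=M+1..M+N. (norm (a n))\<^sup>2)"
  define C where "C = (\<lambda>n. \<Sum>k\<in>P. cnj (A k) * cis (2 * pi * real n * x k))"
  have T0: "T \<ge> 0" and Z0: "Z \<ge> 0" by (auto simp: T_def Z_def intro: sum_nonneg)
  have "complex_of_real T = (\<Sum>k\<in>P. cnj (A k) * A k)"
    unfolding T_def of_real_sum complex_norm_square by (simp add: mult.commute)
  also have "\<dots> = (\<Sum>k\<in>P. \<Sum>n=M+1..M+N. cnj (A k) * (a n * cis (2 * pi * real n * x k)))"
    by (subst (2) A_def) (simp add: sum_distrib_left)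
  also have "\<dots> = (\<Sum>n=M+1..M+N. a n * C n)"
    unfolding C_def sum_distrib_left by (subst sum.swap) (simp add: mult_ac)
  finally have "T = norm (\<Sum>n=M+1..M+N. a n * C n)"
    using T0 by (metis norm_of_real abs_of_nonneg)
  also have "\<dots> \<le> (\<Sum>n=M+1..M+N. norm (a n) * norm (C n))"
    by (intro order.trans[OF norm_sum]) (simp add: norm_mult)
  finally have "T\<^sup>2 \<le> (\<Sum>n=M+1..M+N. norm (a n) * norm (C n))\<^sup>2"
    using T0 by (rule power_mono)
  also have "\<dots> \<le> Z * (\<Sum>n=M+1..M+N. (norm (C n))\<^sup>2)"
    unfolding Z_def by (rule Cauchy_Schwarz_ineq_sum)
  finally have "real N * T\<^sup>2 \<le> Z * (real N * (\<Sum>n=M+1..M+N. (norm (C n))\<^sup>2))"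
    using N by (simp add: mult.left_commute)
  also have "real N * (\<Sum>n=M+1..M+N. (norm (C n))\<^sup>2) \<le> (\<Sum>k\<in>P. \<Sum>l\<in>P. norm (A k) * norm (A l) * D k l)"
    unfolding C_def D_def using sum_norm_sq_window_le[OF P, where N = N and M = M and A = "\<lambda>k. cnj (A k)" and x = x] by simp
  \<comment> \<open>Schur test: splitting the product symmetrically leaves only row sums and column
    sums of \<open>D\<close>, which \<open>K\<close> and \<open>K'\<close> bound.\<close>
  also have "\<dots> \<le> (\<Sum>k\<in>P. \<Sum>l\<in>P. ((norm (A k))\<^sup>2 * D k l + (norm (A l))\<^sup>2 * D k l) / 2)"
  proof (intro sum_mono)
    fix k l
    have "norm (A k) * norm (A l) \<le> ((norm (A k))\<^sup>2 + (norm (A l))\<^sup>2) / 2"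
      using sum_squares_bound[of "norm (A k)" "norm (A l)"] by simp
    then have "norm (A k) * norm (A l) * D k l \<le> ((norm (A k))\<^sup>2 + (norm (A l))\<^sup>2) / 2 * D k l"
      by (rule mult_right_mono) (simp add: D_def)
    then show "norm (A k) * norm (A l) * D k l \<le> ((norm (A k))\<^sup>2 * D k l + (norm (A l))\<^sup>2 * D k l) / 2"
      by (simp add: algebra_simps)
  qed
  also have "\<dots> = ((\<Sum>k\<in>P. (norm (A k))\<^sup>2 * (\<Sum>l\<in>P. D k l)) + (\<Sum>l\<in>P. (norm (A l))\<^sup>2 * (\<Sum>k\<in>P. D k l))) / 2"
    unfolding sum_divide_distrib[symmetric] sum.distrib sum_distrib_left
    by (subst (2) sum.swap) simp
  also have "\<dots> \<le> ((\<Sum>k\<in>P. (norm (A k))\<^sup>2 * B) + (\<Sum>l\<in>P. (norm (A l))\<^sup>2 * B)) / 2"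
    using K K' by (intro divide_right_mono add_mono sum_mono mult_left_mono) (auto simp: D_def)
  also have "\<dots> = T * B" by (simp add: T_def sum_distrib_right)
  finally have "real N * T\<^sup>2 \<le> Z * (T * B)" using Z0 by (simp add: mult_left_mono)
  then have *: "T * (real N * T) \<le> T * (B * Z)" by (simp add: power2_eq_square mult_ac)
  \<comment> \<open>Duality gives an inequality quadratic in \<open>T\<close>; one factor
    \<open>T\<close> is cancelled, and for \<open>T = 0\<close> the claim is mere
    nonnegativity.\<close>
  have "real N * T \<le> B * Z"
  proof (cases "T = 0")
    case True
    with B Z0 show ?thesis by simp
  qed (use * T0 in auto)
  then show ?thesis by (simp add: T_def Z_def A_def)
qed

section \<open>Kernel sums over points with bounded clustering modulo 1\<close>

lemma sum_inverse_squares_le: "(\<Sum>j\<le>n. 1 / (real j + 1)\<^sup>2) \<le> 2 - 1 / (real n + 1)"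
proof (induction n)
  case (Suc n)
  have "1 / (real n + 2)\<^sup>2 \<le> 1 / ((real n + 1) * (real n + 2))"
    by (rule divide_left_mono) (auto simp: power2_eq_square intro: mult_right_mono)
  also have "\<dots> = 1 / (real n + 1) - 1 / (real n + 2)"
    by (simp add: field_simps)
  finally show ?case using Suc by (simp add: add.commute)
qed simp

text \<open>Merges the trivial bound, used for \<open>j = 0\<close>, with the decay bound, used for
  \<open>j \<ge> 1\<close> through \<open>j + 1 \<le> 2 * j\<close>, into one majorant summable over
  \<open>j\<close>.\<close>

lemma dirichlet_kernel_sq_le:
  fixes x :: real and z :: int
  assumes "\<bar>x - z\<bar> \<le> 1/2" and N: "N \<ge> 1" and j: "real j \<le> N * \<bar>x - z\<bar>"
  shows "(norm (dirichlet_kernel (2*N) x))\<^sup>2 \<le> 4 * (real N)\<^sup>2 / (real j + 1)\<^sup>2"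
proof -
  let ?D = "norm (dirichlet_kernel (2*N) x)"
  have "?D * (real j + 1) \<le> 2 * real N"
  proof (cases "j = 0")
    case True
    then show ?thesis using norm_dirichlet_kernel_le[of "2*N" x] by simp
  next
    case False
    have "?D * (real j + 1) \<le> ?D * (2 * real j)"
      using False by (intro mult_left_mono) auto
    also have "\<dots> \<le> ?D * (2 * (N * \<bar>x - z\<bar>))"
      using j by (intro mult_left_mono) auto
    also have "\<dots> = N * (?D * (2 * \<bar>x - z\<bar>))" by simp
    also have "\<dots> \<le> real N * 1"
      using norm_dirichlet_kernel_mult_le[OF assms(1)] by (intro mult_left_mono) auto
    finally show ?thesis by simp
  qed
  then have "?D \<le> 2 * real N / (real j + 1)" by (simp add: field_simps)
  then have "?D\<^sup>2 \<le> (2 * real N / (real j + 1))\<^sup>2" by (rule power_mono) simp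
  then show ?thesis by (simp add: power_divide power_mult_distrib)
qed

text \<open>The points are grouped by the sign of their displacement \<open>s\<close> from \<open>c\<close> modulo 1 and by
  \<open>\<lfloor>N \<bar>s\<bar>\<rfloor>\<close>; two points of the same group are within \<open>1/N\<close> of each other modulo 1.\<close>

lemma sum_dirichlet_kernel_sq_le:
  fixes x :: "'k \<Rightarrow> real" and K :: real
  assumes P: "finite P" and N: "N \<ge> 1"
    and K: "\<And>k. k \<in> P \<Longrightarrow> real (card {l\<in>P. \<exists>z::int. \<bar>x l - x k - z\<bar> \<le> 1 / N}) \<le> K"
    and K0: "K \<ge> 0" and \<sigma>: "\<bar>\<sigma>\<bar> = (1::real)"
  shows "(\<Sum>l\<in>P. (norm (dirichlet_kernel (2*N) (\<sigma> * (x l - c))))\<^sup>2) \<le> 16 * (real N)\<^sup>2 * K"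
proof -
  define y where "y = (\<lambda>l. \<sigma> * (x l - c))"
  define s where "s = (\<lambda>l. y l - of_int (round (y l)))"
  define g where "g = (\<lambda>l. (s l \<ge> 0, nat \<lfloor>N * \<bar>s l\<bar>\<rfloor>))"
  let ?D = "\<lambda>l. (norm (dirichlet_kernel (2*N) (y l)))\<^sup>2"
  have s_half: "\<bar>s l\<bar> \<le> 1/2" for l
    unfolding s_def using of_int_round_abs_le[of "y l"] by (simp add: abs_minus_commute)
  have bucket: "real (card {l\<in>P. g l = t}) \<le> K" for t
  proof (cases "{l\<in>P. g l = t} = {}")
    case True
    show ?thesis unfolding True using K0 by simp
  next
    case False
    then obtain k where k: "k \<in> P" "g k = t" by auto
    have "{l\<in>P. g l = t} \<subseteq> {l\<in>P. \<exists>z::int. \<bar>x l - x k - z\<bar> \<le> 1 / N}"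
    proof safe
      fix l assume l: "l \<in> P" "t = g l"
      with k have eq: "(s l \<ge> 0) = (s k \<ge> 0)" "\<lfloor>N * \<bar>s l\<bar>\<rfloor> = \<lfloor>N * \<bar>s k\<bar>\<rfloor>"
        by (auto simp: g_def nat_eq_iff)
      have "\<bar>N * \<bar>s l\<bar> - N * \<bar>s k\<bar>\<bar> \<le> 1"
        using eq(2) by linarith
      moreover have "\<bar>N * (s l - s k)\<bar> = \<bar>N * \<bar>s l\<bar> - N * \<bar>s k\<bar>\<bar>"
        using eq(1) by (cases "s l \<ge> 0") (auto simp: algebra_simps)
      ultimately have "N * \<bar>s l - s k\<bar> \<le> 1" by (simp add: abs_mult)
      then have 1: "\<bar>s l - s k\<bar> \<le> 1 / N" using N by (simp add: field_simps)
      have "s l - s k = \<sigma> * (x l - x k) - of_int (round (y l) - round (y k))"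
        by (simp add: s_def y_def algebra_simps)
      with 1 have near: "\<bar>\<sigma> * (x l - x k) - of_int (round (y l) - round (y k))\<bar> \<le> 1 / N" by simp
      from \<sigma> consider "\<sigma> = 1" | "\<sigma> = -1" by linarith
      then show "\<exists>z::int. \<bar>x l - x k - z\<bar> \<le> 1 / N"
      proof cases
        case 1
        then show ?thesis using near by (intro exI[of _ "round (y l) - round (y k)"]) simp
      next
        case 2
        then show ?thesis using near
          by (intro exI[of _ "round (y k) - round (y l)"]) (simp add: algebra_simps)
      qed
    qed
    then have "real (card {l\<in>P. g l = t}) \<le> card {l\<in>P. \<exists>z::int. \<bar>x l - x k - z\<bar> \<le> 1 / N}"
      using P by (intro of_nat_mono card_mono) auto
    with K[OF k(1)] show ?thesis by linarith
  qed
  have "g ` P \<subseteq> UNIV \<times> {..N}"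
  proof safe
    fix l b j assume "(b, j) = g l"
    then have "j = nat \<lfloor>N * \<bar>s l\<bar>\<rfloor>" by (simp add: g_def)
    moreover have "N * \<bar>s l\<bar> \<le> real N * 1" using s_half[of l] by (intro mult_left_mono) auto
    ultimately show "j \<le> N" by linarith
  qed auto
  then have "(\<Sum>l\<in>P. ?D l) = (\<Sum>t\<in>UNIV \<times> {..N}. \<Sum>l | l \<in> P \<and> g l = t. ?D l)"
    using P by (intro sum.group[symmetric]) auto
  also have "\<dots> \<le> (\<Sum>t\<in>(UNIV :: bool set) \<times> {..N}. K * (4 * (real N)\<^sup>2 / (real (snd t) + 1)\<^sup>2))"
  proof (intro sum_mono)
    fix t :: "bool \<times> nat"
    have "(\<Sum>l | l \<in> P \<and> g l = t. ?D l) \<le>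
        of_nat (card {l\<in>P. g l = t}) * (4 * (real N)\<^sup>2 / (real (snd t) + 1)\<^sup>2)"
    proof (rule sum_bounded_above)
      fix l assume "l \<in> {l\<in>P. g l = t}"
      then have "real (snd t) \<le> N * \<bar>y l - of_int (round (y l))\<bar>"
        by (auto simp: g_def s_def)
      then show "?D l \<le> 4 * (real N)\<^sup>2 / (real (snd t) + 1)\<^sup>2"
        using s_half[of l] N by (intro dirichlet_kernel_sq_le) (auto simp: s_def)
    qed
    also have "\<dots> \<le> K * (4 * (real N)\<^sup>2 / (real (snd t) + 1)\<^sup>2)"
      using bucket[of t] by (intro mult_right_mono) auto
    finally show "(\<Sum>l | l \<in> P \<and> g l = t. ?D l) \<le> K * (4 * (real N)\<^sup>2 / (real (snd t) + 1)\<^sup>2)" .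
  qed
  \<comment> \<open>The two possible signs of the displacement double the constant 4.\<close>
  also have "\<dots> = 8 * (real N)\<^sup>2 * K * (\<Sum>j\<le>N. 1 / (real j + 1)\<^sup>2)"
    by (simp add: sum.cartesian_product' UNIV_bool sum_distrib_left mult_ac)
  also have "\<dots> \<le> 8 * (real N)\<^sup>2 * K * 2"
  proof (rule mult_left_mono)
    have "0 \<le> 1 / (real N + 1)" by simp
    with sum_inverse_squares_le[of N] show "(\<Sum>j\<le>N. 1 / (real j + 1)\<^sup>2) \<le> 2" by linarith
  qed (use K0 in auto)
  finally show ?thesis by (simp add: y_def)
qed

text \<open>The hypothesis bounds clustering instead of demanding a minimal separation, so
  coinciding points are allowed and counted with multiplicity.\<close>

lemma large_sieve_spacing:
  fixes a :: "nat \<Rightarrow> complex" and x :: "'k \<Rightarrow> real" and K :: real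
  assumes P: "finite P" and N: "N \<ge> 1" and K0: "K \<ge> 0"
    and K: "\<And>k. k \<in> P \<Longrightarrow> real (card {l\<in>P. \<exists>z::int. \<bar>x l - x k - z\<bar> \<le> 1 / N}) \<le> K"
  shows "(\<Sum>k\<in>P. (norm (\<Sum>n=M+1..M+N. a n * cis (2 * pi * real n * x k)))\<^sup>2)
     \<le> 16 * real N * K * (\<Sum>n=M+1..M+N. (norm (a n))\<^sup>2)" (is "?L \<le> _ * ?Z")
proof -
  have "real N * ?L \<le> 16 * (real N)\<^sup>2 * K * ?Z"
  proof (rule large_sieve_kernel[OF P N])
    fix k assume "k \<in> P"
    \<comment> \<open>\<open>\<sigma> = -1\<close> yields the row sums and
      \<open>\<sigma> = 1\<close> the column sums of the Schur test.\<close>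
    show "(\<Sum>l\<in>P. (norm (dirichlet_kernel (2*N) (x k - x l)))\<^sup>2) \<le> 16 * (real N)\<^sup>2 * K"
      using sum_dirichlet_kernel_sq_le[OF P N K K0, of "-1" "x k"] by simp
    show "(\<Sum>l\<in>P. (norm (dirichlet_kernel (2*N) (x l - x k)))\<^sup>2) \<le> 16 * (real N)\<^sup>2 * K"
      using sum_dirichlet_kernel_sq_le[OF P N K K0, of 1 "x k"] by simp
  qed (use K0 in simp)
  also have "\<dots> = real N * (16 * real N * K * ?Z)" by (simp add: power2_eq_square)
  finally show ?thesis using N by simp
qed

section \<open>Counting integers and fractions near a given point\<close>

lemma card_ints_near:
  fixes c r :: real
  assumes "r \<ge> 0"
  shows "finite {i::int. \<bar>i - c\<bar> \<le> r}" "real (card {i::int. \<bar>i - c\<bar> \<le> r}) \<le> 2 * r + 1"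
proof -
  have eq: "{i::int. \<bar>i - c\<bar> \<le> r} = {\<lceil>c - r\<rceil>..\<lfloor>c + r\<rfloor>}"
    by (auto simp: abs_le_iff ceiling_le_iff le_floor_iff)
  show "finite {i::int. \<bar>i - c\<bar> \<le> r}" unfolding eq by simp
  have "real (nat (\<lfloor>c + r\<rfloor> - \<lceil>c - r\<rceil> + 1)) \<le> 2 * r + 1"
    using assms by linarith
  then show "real (card {i::int. \<bar>i - c\<bar> \<le> r}) \<le> 2 * r + 1"
    unfolding eq by (simp add: algebra_simps)
qed

text \<open>Multiplication by \<open>m\<close> sends \<open>b\<close> to the integer
  \<open>b - z * m\<close> close to \<open>m * x\<close>. This is injective because distinct
  elements of \<open>{1..m}\<close> are incongruent modulo \<open>m\<close>.\<close>

lemma card_fractions_near: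
  fixes m :: nat and x r :: real
  assumes m: "m \<ge> 1" and r: "r \<ge> 0"
  shows "real (card {b\<in>{1..m}. \<exists>z::int. \<bar>b / m - x - z\<bar> \<le> r}) \<le> 2 * (r * m) + 1"
proof -
  let ?B = "{b\<in>{1..m}. \<exists>z::int. \<bar>b / m - x - z\<bar> \<le> r}"
  define z where "z = (\<lambda>b::nat. SOME z::int. \<bar>b / m - x - z\<bar> \<le> r)"
  have z: "\<bar>b / m - x - z b\<bar> \<le> r" if "\<exists>z::int. \<bar>b / m - x - z\<bar> \<le> r" for b :: nat
    using that unfolding z_def by (rule someI_ex)
  define f where "f = (\<lambda>b. int b - z b * int m)"
  have "inj_on f ?B"
  proof (rule inj_onI)
    fix b b' assume b: "b \<in> ?B" "b' \<in> ?B" "f b = f b'"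
    then have eq: "int b - int b' = (z b - z b') * int m" by (simp add: f_def algebra_simps)
    have "\<bar>int b - int b'\<bar> < int m" using b(1,2) m by auto
    with eq have "\<bar>z b - z b'\<bar> * int m < 1 * int m" by (simp add: abs_mult)
    then have "z b - z b' = 0" using m by (auto simp del: mult_1)
    with eq show "b = b'" by simp
  qed
  moreover have "f ` ?B \<subseteq> {i::int. \<bar>i - m * x\<bar> \<le> r * m}"
  proof (rule image_subsetI)
    fix b assume "b \<in> ?B"
    then have b: "\<exists>z::int. \<bar>b / m - x - z\<bar> \<le> r" by simp
    have "\<bar>b / m - x - z b\<bar> * m \<le> r * m" by (intro mult_right_mono z b) auto
    also have "\<bar>b / m - x - z b\<bar> * m = \<bar>(b / m - x - z b) * m\<bar>" by (simp add: abs_mult)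
    also have "(b / m - x - z b) * m = f b - m * x"
      using m by (simp add: f_def field_simps)
    finally show "f b \<in> {i::int. \<bar>i - m * x\<bar> \<le> r * m}" by simp
  qed
  ultimately have "card ?B \<le> card {i::int. \<bar>i - m * x\<bar> \<le> r * m}"
    using r by (intro card_inj_on_le card_ints_near) auto
  also have "real \<dots> \<le> 2 * (r * m) + 1"
    using r by (intro card_ints_near) auto
  finally show ?thesis by simp
qed

text \<open>An admissible \<open>h\<close> is encoded by \<open>h * b - z * s\<close> and
  \<open>h div s\<close>. The first fixes \<open>h\<close> modulo \<open>s\<close>, as
  \<open>b\<close> is invertible there, and is at most \<open>r * s\<close> in absolute value; the
  second fixes \<open>h\<close> within its residue class.\<close>

lemma card_multiples_near_ints:
  fixes H r :: real and b s :: nat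
  assumes s: "s \<ge> 1" and cop: "coprime b s" and H: "H \<ge> 0" and r: "r \<ge> 0"
  defines "A \<equiv> {h::int. \<bar>real_of_int h\<bar> \<le> H \<and> (\<exists>z::int. \<bar>h * (b / s) - z\<bar> \<le> r)}"
  shows "finite A" "real (card A) \<le> (2 * (r * s) + 1) * (2 * (H / s) + 2)"
proof -
  \<comment> \<open>The quotient \<open>h div s\<close> is a floor, so it lies between
    \<open>- H/s - 1\<close> and \<open>H/s\<close>; hence the centre \<open>-1/2\<close>.\<close>
  let ?R = "{i::int. \<bar>i - 0\<bar> \<le> r * s}" and ?Q = "{i::int. \<bar>i - (-1/2)\<bar> \<le> H / s + 1/2}"
  have "\<forall>h\<in>A. \<exists>z::int. \<bar>h * (b / s) - z\<bar> \<le> r" by (auto simp: A_def)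
  then obtain z :: "int \<Rightarrow> int" where z: "\<And>h. h \<in> A \<Longrightarrow> \<bar>h * (b / s) - z h\<bar> \<le> r"
    by metis
  define f where "f = (\<lambda>h. (h * int b - z h * int s, h div int s))"
  have inj: "inj_on f A"
  proof (rule inj_onI)
    fix h h' assume "f h = f h'"
    then have eq: "(h - h') * int b = (z h - z h') * int s" and q: "h div int s = h' div int s"
      by (auto simp: f_def algebra_simps)
    from eq have "int s dvd (h - h') * int b" by simp
    then have "int s dvd h - h'"
      using cop by (simp add: coprime_dvd_mult_left_iff coprime_commute)
    then have "h mod int s = h' mod int s" by (simp add: mod_eq_dvd_iff)
    with q show "h = h'" by (metis mult_div_mod_eq)
  qed
  have sub: "f ` A \<subseteq> ?R \<times> ?Q"
  proof (rule image_subsetI)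
    fix h assume h: "h \<in> A"
    have "\<bar>h * (b / s) - z h\<bar> * s \<le> r * s" by (intro mult_right_mono z h) auto
    also have "\<bar>h * (b / s) - z h\<bar> * s = \<bar>(h * (b / s) - z h) * s\<bar>" by (simp add: abs_mult)
    also have "(h * (b / s) - z h) * s = of_int (h * int b - z h * int s)"
      using s by (simp add: field_simps)
    finally have 1: "\<bar>of_int (h * int b - z h * int s) - (0::real)\<bar> \<le> r * s" by simp
    have "h div int s = \<lfloor>h / s\<rfloor>"
      by (metis floor_divide_of_int_eq of_int_of_nat_eq)
    moreover have "\<bar>h / s\<bar> \<le> H / s"
      using h s by (simp add: A_def divide_right_mono)
    ultimately have 2: "\<bar>of_int (h div int s) - (-1/2::real)\<bar> \<le> H / s + 1/2" by linarith
    from 1 2 show "f h \<in> ?R \<times> ?Q" by (simp add: f_def)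
  qed
  have fin: "finite ?R" "finite ?Q" and
    cR: "real (card ?R) \<le> 2 * (r * s) + 1" and cQ: "real (card ?Q) \<le> 2 * (H / s + 1/2) + 1"
    by (intro card_ints_near; use r H in simp)+
  show "finite A" using inj sub fin by (meson finite_SigmaI inj_on_finite)
  have "card A \<le> card (?R \<times> ?Q)" using inj sub fin by (intro card_inj_on_le) auto
  then have "real (card A) \<le> real (card ?R) * real (card ?Q)"
    by (metis card_cartesian_product of_nat_le_iff of_nat_mult)
  also have "\<dots> \<le> (2 * (r * s) + 1) * (2 * (H / s + 1/2) + 1)"
    using cR cQ r by (intro mult_mono) auto
  finally show "real (card A) \<le> (2 * (r * s) + 1) * (2 * (H / s) + 2)" by (simp add: algebra_simps)
qed

section \<open>From clustering of fractions to additive energy\<close>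

text \<open>The quadruples from \<open>J\<close> are sorted by their difference \<open>h\<close>:
  those with \<open>h = 0\<close> are counted by the energy, and each other class by at most the
  maximal shifted energy.\<close>

lemma card_power4_le_energy:
  fixes m :: "nat \<Rightarrow> nat"
  assumes I: "finite I" and J: "J \<subseteq> I" and S: "finite S" "0 \<notin> S"
    and diff: "\<And>i1 j1 i2 j2. i1 \<in> J \<Longrightarrow> j1 \<in> J \<Longrightarrow> i2 \<in> J \<Longrightarrow> j2 \<in> J \<Longrightarrow>
      int (m i1) + int (m j1) - int (m i2) - int (m j2) \<in> insert 0 S"
  shows "card J ^ 4 \<le> fam_energy (\<lambda>j. real (m j)) I + card S * fam_energy_star (\<lambda>j. real (m j)) I"
proof -
  define X where "X = (\<lambda>h::int. {(i1, j1, i2, j2). i1 \<in> I \<and> j1 \<in> I \<and> i2 \<in> I \<and> j2 \<in> I \<and>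
     real (m i1) + real (m j1) = real (m i2) + real (m j2) + of_int h})"
  have fin: "finite (X h)" for h
    by (rule finite_subset[of _ "I \<times> I \<times> I \<times> I"]) (use I in \<open>auto simp: X_def\<close>)
  have star: "card (X h) \<le> fam_energy_star (\<lambda>j. real (m j)) I" if "h \<noteq> 0" for h
    unfolding fam_energy_star_def
    by (rule Max_ge[OF finite_fam_energy_shifts[OF I]])
       (use that in \<open>auto simp: X_def fam_energy_shift_def\<close>)
  have "J \<times> J \<times> J \<times> J \<subseteq> (\<Union>h\<in>insert 0 S. X h)"
  proof clarify
    fix i1 j1 i2 j2 assume q: "i1 \<in> J" "j1 \<in> J" "i2 \<in> J" "j2 \<in> J"
    then have "(i1, j1, i2, j2) \<in> X (int (m i1) + int (m j1) - int (m i2) - int (m j2))"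
      using J by (auto simp: X_def)
    with diff[OF q] show "(i1, j1, i2, j2) \<in> (\<Union>h\<in>insert 0 S. X h)" by blast
  qed
  then have "card (J \<times> J \<times> J \<times> J) \<le> card (\<Union>h\<in>insert 0 S. X h)"
    using S fin by (intro card_mono) auto
  also have "\<dots> \<le> (\<Sum>h\<in>insert 0 S. card (X h))"
    using S by (intro card_UN_le) auto
  also have "\<dots> = card (X 0) + (\<Sum>h\<in>S. card (X h))" using S by simp
  also have "(\<Sum>h\<in>S. card (X h)) \<le> card S * fam_energy_star (\<lambda>j. real (m j)) I"
    using sum_bounded_above[of S "\<lambda>h. card (X h)"] S star by (metis of_nat_id)
  also have "card (X 0) = fam_energy (\<lambda>j. real (m j)) I"
    by (simp add: X_def fam_energy_def)
  finally show ?thesis by (simp add: card_cartesian_product power4_eq_xxxx mult.assoc)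
qed

lemma power4_powr_quarter:
  fixes x :: real
  assumes "x \<ge> 0"
  shows "(x ^ 4) powr (1/4) = x"
proof (cases "x = 0")
  case False
  then have "x ^ 4 = x powr 4" using assms by simp
  then show ?thesis using assms by (simp only: powr_powr) simp
qed simp

text \<open>This supplies the clustering bound required by \<open>large_sieve_spacing\<close>. A
  nearby pair \<open>(j, b)\<close> forces \<open>m j * x\<close> to be close to an integer, so
  \<open>j\<close> lies in \<open>J\<close>; each such \<open>j\<close> carries at most
  \<open>2 * U / N + 1\<close> numerators, and \<open>card J\<close> is controlled by the
  energies.\<close>

lemma card_spacing_le:
  fixes m :: "nat \<Rightarrow> nat" and T U :: real and N :: nat
  assumes A: "finite A" and I: "I \<subseteq> A" and N: "N \<ge> 1" and T: "T > 0"
    and m: "\<And>j. j \<in> I \<Longrightarrow> T \<le> m j" "\<And>j. j \<in> I \<Longrightarrow> m j \<le> U"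
    and k: "j0 \<in> I" "coprime b0 (m j0)"
  shows "real (card {(j, b) \<in> Sigma I (\<lambda>j. {b\<in>{1..m j}. coprime b (m j)}).
      \<exists>z::int. \<bar>b / m j - b0 / m j0 - z\<bar> \<le> 1 / N})
    \<le> (2 * U / N + 1) * (real (fam_energy (\<lambda>j. real (m j)) A)
        + real (fam_energy_star (\<lambda>j. real (m j)) A) * ((8 * U\<^sup>2 / N + 1) * (4 * U / T + 2))) powr (1/4)"
    (is "real (card ?L) \<le> _ * ?E powr _")
proof -
  define x where "x = real b0 / real (m j0)"
  define J where "J = {j\<in>I. \<exists>w::int. \<bar>m j * x - w\<bar> \<le> U / N}"
  \<comment> \<open>\<open>S\<close> captures every difference of two sums of two moduli from
    \<open>J\<close>: sums of two moduli lie in \<open>[0, 2 * U]\<close>, and four approximation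
    errors of size \<open>U / N\<close> add up.\<close>
  define S where "S = {h::int. \<bar>real_of_int h\<bar> \<le> 2 * U \<and> (\<exists>z::int. \<bar>h * x - z\<bar> \<le> 4 * (U / N))}"
  have m1: "m j \<ge> 1" if "j \<in> I" for j using m(1)[OF that] T by (cases "m j") auto
  have U: "T \<le> U" "U > 0" using m[OF k(1)] T by linarith+
  have finJ: "finite J" and JA: "J \<subseteq> A"
    using A I by (auto simp: J_def intro: finite_subset)
  let ?B = "\<lambda>j. {b\<in>{1..m j}. \<exists>z::int. \<bar>b / m j - x - z\<bar> \<le> 1 / N}"
  have "?L \<subseteq> Sigma J ?B"
  proof
    fix p assume "p \<in> ?L"
    then obtain j b and z :: int where p: "p = (j, b)" and j: "j \<in> I" "b \<in> {1..m j}"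
      and z: "\<bar>b / m j - b0 / m j0 - z\<bar> \<le> 1 / real N"
      by auto
    have "\<bar>b / m j - x - z\<bar> * m j \<le> 1 / N * U"
      using z m(2)[OF j(1)] by (intro mult_mono) (auto simp: x_def)
    also have "\<bar>b / m j - x - z\<bar> * m j = \<bar>(b / m j - x - z) * m j\<bar>" by (simp add: abs_mult)
    also have "(b / m j - x - z) * m j = - (m j * x - of_int (int b - z * m j))"
      using m1[OF j(1)] by (simp add: field_simps)
    finally have "\<bar>m j * x - of_int (int b - z * m j)\<bar> \<le> U / N" by simp
    then have "j \<in> J" using j(1) unfolding J_def by blast
    with j z show "p \<in> Sigma J ?B" by (auto simp: p x_def)
  qed
  then have "card ?L \<le> card (Sigma J ?B)" using finJ by (intro card_mono) auto
  also have "\<dots> = (\<Sum>j\<in>J. card (?B j))" using finJ by simp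
  finally have "real (card ?L) \<le> real (\<Sum>j\<in>J. card (?B j))" by (rule of_nat_mono)
  also have "\<dots> = (\<Sum>j\<in>J. real (card (?B j)))" by (rule of_nat_sum)
  also have "\<dots> \<le> real (card J) * (2 * U / N + 1)"
  proof (rule sum_bounded_above)
    fix j assume "j \<in> J"
    then have j: "j \<in> I" by (auto simp: J_def)
    have "real (card (?B j)) \<le> 2 * (1 / N * m j) + 1"
      using m1[OF j] by (intro card_fractions_near) auto
    also have "1 / N * m j \<le> 1 / N * U" using m(2)[OF j] by (intro mult_left_mono) auto
    finally show "real (card (?B j)) \<le> 2 * U / N + 1" by simp
  qed
  finally have L: "real (card ?L) \<le> (2 * U / N + 1) * real (card J)" by (simp add: mult.commute)
  have finS: "finite S"
    unfolding S_def x_def using m1[OF k(1)] k U by (intro card_multiples_near_ints(1)) auto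
  have "real (card S) \<le> (2 * (4 * (U / N) * m j0) + 1) * (2 * (2 * U / m j0) + 2)"
    unfolding S_def x_def using m1[OF k(1)] k U by (intro card_multiples_near_ints(2)) auto
  \<comment> \<open>The modulus \<open>m j0\<close> is replaced by \<open>U\<close> where it
    multiplies and by \<open>T\<close> where it divides; the resulting loss \<open>U / T\<close> is
    the reason for splitting into blocks.\<close>
  also have "\<dots> \<le> (2 * (4 * (U / N) * U) + 1) * (2 * (2 * U / T) + 2)"
    using m[OF k(1)] m1[OF k(1)] U T N
    by (intro mult_mono add_mono divide_left_mono) auto
  finally have S: "real (card S) \<le> (8 * U\<^sup>2 / N + 1) * (4 * U / T + 2)"
    by (simp add: power2_eq_square)
  have "card J ^ 4 \<le> fam_energy (\<lambda>j. real (m j)) A + card (S - {0}) * fam_energy_star (\<lambda>j. real (m j)) A"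
  proof (rule card_power4_le_energy[OF A JA])
    fix i1 j1 i2 j2 assume q: "i1 \<in> J" "j1 \<in> J" "i2 \<in> J" "j2 \<in> J"
    define h where "h = int (m i1) + int (m j1) - int (m i2) - int (m j2)"
    obtain w1 w2 w3 w4 :: int where w: "\<bar>m i1 * x - w1\<bar> \<le> U / N" "\<bar>m j1 * x - w2\<bar> \<le> U / N"
        "\<bar>m i2 * x - w3\<bar> \<le> U / N" "\<bar>m j2 * x - w4\<bar> \<le> U / N"
      using q unfolding J_def by blast
    have "h * x - of_int (w1 + w2 - w3 - w4)
        = (m i1 * x - w1) + (m j1 * x - w2) - (m i2 * x - w3) - (m j2 * x - w4)"
      by (simp add: h_def algebra_simps)
    with w have "\<bar>h * x - of_int (w1 + w2 - w3 - w4)\<bar> \<le> 4 * (U / N)" by linarith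
    moreover have "m i1 \<le> U" "m j1 \<le> U" "m i2 \<le> U" "m j2 \<le> U" using q m(2) by (auto simp: J_def)
    then have "\<bar>real_of_int h\<bar> \<le> 2 * U" by (simp add: h_def)
    ultimately show "h \<in> insert 0 (S - {0})" unfolding S_def by blast
  qed (use finS in auto)
  moreover have "card (S - {0}) \<le> card S" using finS by (intro card_mono) auto
  ultimately have "card J ^ 4 \<le> fam_energy (\<lambda>j. real (m j)) A + card S * fam_energy_star (\<lambda>j. real (m j)) A"
    by (meson add_left_mono mult_right_mono le_trans zero_le)
  then have "real (card J ^ 4) \<le> real (fam_energy (\<lambda>j. real (m j)) A + card S * fam_energy_star (\<lambda>j. real (m j)) A)"
    by (rule of_nat_mono)
  also have "\<dots> = fam_energy (\<lambda>j. real (m j)) A + fam_energy_star (\<lambda>j. real (m j)) A * real (card S)"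
    by simp
  also have "\<dots> \<le> ?E"
    using S by (intro add_left_mono mult_left_mono) auto
  finally have "real (card J ^ 4) powr (1/4) \<le> ?E powr (1/4)" by (intro powr_mono2) auto
  moreover have "real (card J ^ 4) powr (1/4) = real (card J)"
    using power4_powr_quarter[of "real (card J)"] by simp
  ultimately have "real (card J) \<le> ?E powr (1/4)" by simp
  then have "(2 * U / N + 1) * real (card J) \<le> (2 * U / N + 1) * ?E powr (1/4)"
    using U by (intro mult_left_mono) auto
  with L show ?thesis by linarith
qed

text \<open>The sieve points are indexed by pairs \<open>(j, b)\<close>, so repeated moduli keep
  their multiplicity. The energies are those of the whole family \<open>A\<close>, which makes the
  bounds of different blocks directly summable.\<close>

lemma sieve_block_le:
  fixes m :: "nat \<Rightarrow> nat" and T U :: real and N :: nat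
  assumes A: "finite A" and I: "I \<subseteq> A" and N: "N \<ge> 1" and T: "T > 0" and U: "U \<ge> 0"
    and m: "\<And>j. j \<in> I \<Longrightarrow> T \<le> m j" "\<And>j. j \<in> I \<Longrightarrow> m j \<le> U"
  shows "(\<Sum>j\<in>I. \<Sum>b | b \<in> {1..m j} \<and> coprime b (m j).
     (cmod (\<Sum>n=M+1..M+N. a n * add_char (of_nat b * of_nat n / of_nat (m j))))\<^sup>2)
    \<le> 16 * real N * ((2 * U / N + 1) * (real (fam_energy (\<lambda>j. real (m j)) A)
        + real (fam_energy_star (\<lambda>j. real (m j)) A) * ((8 * U\<^sup>2 / N + 1) * (4 * U / T + 2))) powr (1/4))
      * (\<Sum>n=M+1..M+N. (cmod (a n))\<^sup>2)"
    (is "_ \<le> _ * ?K * ?Z")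
proof -
  define P where "P = Sigma I (\<lambda>j. {b\<in>{1..m j}. coprime b (m j)})"
  define x where "x = (\<lambda>(j, b). real b / real (m j))"
  have finI: "finite I" using A I by (rule finite_subset[rotated])
  have e: "add_char (of_nat b * of_nat n / of_nat (m j)) = cis (2 * pi * real n * x (j, b))" for j b n
    unfolding add_char_def x_def cis_conv_exp by (simp add: mult_ac)
  have "(\<Sum>j\<in>I. \<Sum>b | b \<in> {1..m j} \<and> coprime b (m j).
      (cmod (\<Sum>n=M+1..M+N. a n * add_char (of_nat b * of_nat n / of_nat (m j))))\<^sup>2)
    = (\<Sum>k\<in>P. (cmod (\<Sum>n=M+1..M+N. a n * cis (2 * pi * real n * x k)))\<^sup>2)"
    unfolding e P_def using finI by (subst sum.Sigma) (auto simp: case_prod_unfold)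
  also have "\<dots> \<le> 16 * real N * ?K * ?Z"
  proof (rule large_sieve_spacing[OF _ N])
    show "finite P" using finI by (auto simp: P_def)
    show "?K \<ge> 0" using U by simp
    fix k assume "k \<in> P"
    then obtain j0 b0 where k: "k = (j0, b0)" "j0 \<in> I" "coprime b0 (m j0)" by (auto simp: P_def)
    have "{l\<in>P. \<exists>z::int. \<bar>x l - x k - z\<bar> \<le> 1 / N}
      = {(j, b) \<in> Sigma I (\<lambda>j. {b\<in>{1..m j}. coprime b (m j)}).
          \<exists>z::int. \<bar>b / m j - b0 / m j0 - z\<bar> \<le> 1 / N}"
      by (auto simp: P_def x_def k(1))
    then show "real (card {l\<in>P. \<exists>z::int. \<bar>x l - x k - z\<bar> \<le> 1 / N}) \<le> ?K"
      using card_spacing_le[where m = m, OF A I N T m k(2,3)] by simp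
  qed
  finally show ?thesis .
qed

section \<open>Real powers and the growth of the moduli\<close>

text \<open>After taking fourth powers, the right side exceeds the left by the mixed binomial terms,
  which are nonnegative.\<close>

lemma powr_quarter_add_le:
  fixes x y :: real
  assumes "x \<ge> 0" "y \<ge> 0"
  shows "(x + y) powr (1/4) \<le> x powr (1/4) + y powr (1/4)"
proof -
  have root: "(z powr (1/4)) ^ 4 = z" if "z \<ge> 0" for z :: real
    using that by (cases "z = 0") (simp_all add: powr_powr flip: powr_realpow)
  let ?u = "x powr (1/4)" and ?v = "y powr (1/4)"
  have "((x + y) powr (1/4)) ^ 4 = ?u ^ 4 + ?v ^ 4" using assms by (simp add: root)
  also have "\<dots> \<le> ?u ^ 4 + ?v ^ 4 + (4 * ?u^3 * ?v + 6 * ?u^2 * ?v^2 + 4 * ?u * ?v^3)"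
    by simp
  also have "\<dots> = (?u + ?v) ^ 4" by algebra
  finally show ?thesis by (rule power_le_imp_le_base[where n = 3, simplified]) simp
qed

text \<open>Serves to absorb a constant into a small power of \<open>Q\<close> once \<open>Q\<close>
  passes an explicit threshold.\<close>

lemma le_powr_of_powr_inverse_le:
  fixes B p x :: real
  assumes "B \<ge> 0" "p > 0" "B powr (1/p) \<le> x"
  shows "B \<le> x powr p"
proof -
  have "B = (B powr (1/p)) powr p" using assms by (simp add: powr_powr)
  also have "\<dots> \<le> x powr p" using assms by (intro powr_mono2) auto
  finally show ?thesis .
qed

text \<open>For large \<open>j\<close> the exponent is below \<open>\<alpha> + \<delta>\<close> and
  \<open>j \<le> Q\<close>. The finitely many remaining moduli are bounded by a constant, which a
  large \<open>Q\<close> absorbs.\<close>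

lemma eventually_moduli_le:
  fixes m :: "nat \<Rightarrow> nat" and \<eta> :: "nat \<Rightarrow> real"
  assumes \<alpha>: "\<alpha> > 0" and \<delta>: "\<delta> > 0" and \<eta>: "\<eta> \<longlonglongrightarrow> 0"
    and m: "\<forall>\<^sub>F j in sequentially. real (m j) = real j powr (\<alpha> + \<eta> j)"
  shows "\<exists>Q0. \<forall>Q\<ge>Q0. \<forall>j\<in>{1..Q}. real (m j) \<le> real Q powr (\<alpha> + \<delta>)"
proof -
  have "\<forall>\<^sub>F j in sequentially. \<eta> j < \<delta>" using \<eta> \<delta> by (rule order_tendstoD)
  with m have "\<forall>\<^sub>F j in sequentially. real (m j) = real j powr (\<alpha> + \<eta> j) \<and> \<eta> j < \<delta>"
    by (rule eventually_conj)
  then obtain J where J: "\<And>j. j \<ge> J \<Longrightarrow> real (m j) = real j powr (\<alpha> + \<eta> j) \<and> \<eta> j < \<delta>"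
    unfolding eventually_sequentially by blast
  define B where "B = real (\<Sum>j<J. m j)"
  show ?thesis
  proof (intro exI[of _ "nat \<lceil>B powr (1 / (\<alpha> + \<delta>))\<rceil>"] allI impI ballI)
    fix Q j assume Q: "Q \<ge> nat \<lceil>B powr (1 / (\<alpha> + \<delta>))\<rceil>" and j: "j \<in> {1..Q}"
    show "real (m j) \<le> real Q powr (\<alpha> + \<delta>)"
    proof (cases "j < J")
      case True
      then have "m j \<le> (\<Sum>j<J. m j)" by (intro member_le_sum) auto
      then have "real (m j) \<le> B" unfolding B_def by (rule of_nat_mono)
      also have "B \<le> real Q powr (\<alpha> + \<delta>)"
        using \<alpha> \<delta> Q by (intro le_powr_of_powr_inverse_le) (auto simp: B_def nat_le_iff ceiling_le_iff sum_nonneg)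
      finally show ?thesis .
    next
      case False
      with J[of j] have "real (m j) \<le> real j powr (\<alpha> + \<delta>)"
        using j by (auto intro: powr_mono)
      also have "\<dots> \<le> real Q powr (\<alpha> + \<delta>)" using j \<alpha> \<delta> by (intro powr_mono2) auto
      finally show ?thesis .
    qed
  qed
qed

section \<open>Summation over blocks of comparable moduli\<close>

text \<open>Here \<open>E\<close> and \<open>F\<close> stand for the energy and the maximal shifted
  energy. The number of shifts is about \<open>q powr (2 * \<alpha>) / n\<close> up to powers of
  \<open>q powr \<delta>\<close>; its fourth root times \<open>n\<close> produces
  \<open>n powr (3/4) * q powr (\<alpha>/2)\<close>.\<close>

lemma block_constant_le:
  fixes q n \<alpha> \<delta> T U E F :: real
  assumes q: "q \<ge> 1" and \<delta>: "\<delta> > 0" and T: "T > 0"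
    and n: "q powr \<alpha> \<le> n" "n \<le> q powr (2 * \<alpha>)"
    and U: "U = q powr \<delta> * T" "U \<le> q powr (\<alpha> + 2 * \<delta>)"
    and EF: "E \<ge> 0" "F \<ge> 0"
  shows "16 * n * ((2 * U / n + 1) * (E + F * ((8 * U\<^sup>2 / n + 1) * (4 * U / T + 2))) powr (1/4))
    \<le> 144 * q powr (4 * \<delta>) * (n * E powr (1/4) + n powr (3/4) * q powr (\<alpha>/2) * F powr (1/4))"
proof -
  have n0: "n > 0" using n q by (smt (verit) powr_gt_zero)
  have ge1: "q powr t \<ge> 1" if "t \<ge> 0" for t using q that by (rule ge_one_powr_ge_zero)
  have U0: "U \<ge> 0" using U T by simp
  define X where "X = (8 * U\<^sup>2 / n + 1) * (4 * U / T + 2)"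
  have X0: "X \<ge> 0" using U0 n0 T by (simp add: X_def)
  have 1: "2 * U / n + 1 \<le> 3 * q powr (2 * \<delta>)"
  proof -
    have "U / n \<le> q powr (\<alpha> + 2 * \<delta>) / q powr \<alpha>"
      using U n q U0 by (intro frac_le) auto
    also have "\<dots> = q powr (2 * \<delta>)" using q by (simp add: powr_add)
    finally show ?thesis using ge1[of "2 * \<delta>"] \<delta> by simp
  qed
  have 2: "8 * U\<^sup>2 / n + 1 \<le> 9 * (q powr (2 * \<alpha> + 4 * \<delta>) / n)"
  proof -
    have "U\<^sup>2 \<le> (q powr (\<alpha> + 2 * \<delta>))\<^sup>2" using U U0 by (intro power_mono) auto
    also have "\<dots> = q powr (2 * \<alpha> + 4 * \<delta>)"
      by (simp add: power2_eq_square flip: powr_add)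
    finally have "U\<^sup>2 / n \<le> q powr (2 * \<alpha> + 4 * \<delta>) / n" using n0 by (intro divide_right_mono) auto
    \<comment> \<open>The upper bound on \<open>n\<close> lets the summand 1 be absorbed into the
      quotient.\<close>
    moreover have "n \<le> q powr (2 * \<alpha> + 4 * \<delta>)"
      using n(2) q \<delta> by (rule_tac order.trans[OF n(2)], intro powr_mono) auto
    then have "1 \<le> q powr (2 * \<alpha> + 4 * \<delta>) / n" using n0 by simp
    ultimately show ?thesis by simp
  qed
  have 3: "4 * U / T + 2 \<le> 6 * q powr \<delta>"
    using ge1[of \<delta>] \<delta> T by (simp add: U(1))
  have "X \<le> 9 * (q powr (2 * \<alpha> + 4 * \<delta>) / n) * (6 * q powr \<delta>)"
    unfolding X_def using 2 3 n0 U0 T by (intro mult_mono) auto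
  also have "\<dots> = 54 * (q powr (2 * \<alpha> + 5 * \<delta>) * n powr (-1))"
    using n0 by (simp add: powr_minus_divide powr_add[symmetric] algebra_simps)
  \<comment> \<open>Rounding 54 up to \<open>81 = 3 ^ 4\<close> makes the fourth root of the
    constant exact.\<close>
  also have "\<dots> \<le> 3 powr 4 * (q powr (2 * \<alpha> + 5 * \<delta>) * n powr (-1))"
    by (intro mult_right_mono) (auto simp: powr_numeral)
  finally have "X powr (1/4) \<le> (3 powr 4 * (q powr (2 * \<alpha> + 5 * \<delta>) * n powr (-1))) powr (1/4)"
    using X0 by (intro powr_mono2) auto
  also have "\<dots> = 3 powr (4 * (1/4)) * (q powr ((2 * \<alpha> + 5 * \<delta>) * (1/4)) * n powr (- 1 * (1/4)))"
    using n0 q by (simp only: powr_mult powr_powr)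
  also have "\<dots> = 3 * q powr (\<alpha>/2 + 5 * \<delta> / 4) * n powr (-1/4)"
    by (simp add: add_divide_distrib)
  also have "\<dots> = 3 * q powr (5 * \<delta> / 4) * (q powr (\<alpha>/2) * n powr (-1/4))"
    by (simp add: powr_add)
  finally have X: "X powr (1/4) \<le> 3 * q powr (5 * \<delta> / 4) * (q powr (\<alpha>/2) * n powr (-1/4))" .
  define G where "G = F powr (1/4) * (q powr (\<alpha>/2) * n powr (-1/4))"
  have G0: "G \<ge> 0" by (simp add: G_def)
  have qd: "q powr (5 * \<delta> / 4) \<ge> 1" using \<delta> by (intro ge1) auto
  have "(E + F * X) powr (1/4) \<le> E powr (1/4) + (F * X) powr (1/4)"
    using EF X0 by (intro powr_quarter_add_le) auto
  also have "(F * X) powr (1/4) = F powr (1/4) * X powr (1/4)" by (simp add: powr_mult)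
  also have "\<dots> \<le> F powr (1/4) * (3 * q powr (5 * \<delta> / 4) * (q powr (\<alpha>/2) * n powr (-1/4)))"
    using X by (intro mult_left_mono) auto
  also have "\<dots> = 3 * q powr (5 * \<delta> / 4) * G" by (simp add: G_def)
  also have "E powr (1/4) + 3 * q powr (5 * \<delta> / 4) * G \<le> 3 * q powr (5 * \<delta> / 4) * (E powr (1/4) + G)"
    using mult_right_mono[of 1 "3 * q powr (5 * \<delta> / 4)" "E powr (1/4)"] qd by (simp add: distrib_left)
  finally have "(2 * U / n + 1) * (E + F * X) powr (1/4)
      \<le> 3 * q powr (2 * \<delta>) * (3 * q powr (5 * \<delta> / 4) * (E powr (1/4) + G))"
    using 1 by (intro mult_mono) auto
  also have "\<dots> = 9 * q powr (2 * \<delta> + 5 * \<delta> / 4) * (E powr (1/4) + G)"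
    unfolding powr_add by simp
  also have "\<dots> \<le> 9 * q powr (4 * \<delta>) * (E powr (1/4) + G)"
    using q \<delta> G0 by (intro mult_right_mono mult_left_mono powr_mono) auto
  finally have "16 * n * ((2 * U / n + 1) * (E + F * X) powr (1/4))
      \<le> 16 * n * (9 * q powr (4 * \<delta>) * (E powr (1/4) + G))"
    using n0 by (intro mult_left_mono) auto
  also have "\<dots> = 144 * q powr (4 * \<delta>) * (n * E powr (1/4) + n * G)"
    by (simp add: algebra_simps)
  also have "n * G = (n powr 1 * n powr (-1/4)) * q powr (\<alpha>/2) * F powr (1/4)"
    using n0 by (simp add: G_def)
  also have "n powr 1 * n powr (-1/4) = n powr (3/4)"
    by (simp only: powr_add[symmetric]) simp
  finally show ?thesis by (simp add: X_def)
qed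

text \<open>The moduli are split into boundedly many blocks in which they agree up to a factor
  \<open>Q powr \<delta>\<close>.\<close>

lemma sieve_sum_le:
  fixes m :: "nat \<Rightarrow> nat" and \<alpha> \<delta> :: real
  assumes Q: "Q \<ge> 2" and \<delta>: "\<delta> > 0" and \<alpha>: "\<alpha> > 0"
    and N: "N \<ge> 1" "real Q powr \<alpha> \<le> real N" "real N \<le> real Q powr (2 * \<alpha>)"
    and pos: "\<And>j. j \<in> {1..Q} \<Longrightarrow> m j > 0"
    and m: "\<And>j. j \<in> {1..Q} \<Longrightarrow> real (m j) \<le> real Q powr (\<alpha> + \<delta>)"
  defines "R \<equiv> real N * real (fam_energy (\<lambda>j. real (m j)) {1..Q}) powr (1/4)
              + real N powr (3/4) * real Q powr (\<alpha>/2)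
                * real (fam_energy_star (\<lambda>j. real (m j)) {1..Q}) powr (1/4)"
  shows "sieve_sum m Q M N a \<le> ((\<alpha> + \<delta>) / \<delta> + 1) *
    (144 * real Q powr (4 * \<delta>) * R * (\<Sum>n=M+1..M+N. (cmod (a n))\<^sup>2))"
proof -
  let ?q = "real Q" and ?Z = "\<Sum>n=M+1..M+N. (cmod (a n))\<^sup>2"
  \<comment> \<open>Block index: \<open>m j\<close> lies between the powers of
    \<open>?q powr \<delta>\<close> with exponents \<open>c j\<close> and
    \<open>c j + 1\<close>.\<close>
  define c where "c = (\<lambda>j. nat \<lfloor>log (?q powr \<delta>) (m j)\<rfloor>)"
  \<comment> \<open>Largest possible block index; it does not depend on \<open>Q\<close>, so the
    number of blocks is bounded.\<close>
  define C where "C = nat \<lfloor>(\<alpha> + \<delta>) / \<delta>\<rfloor>"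
  define g where "g = (\<lambda>j. \<Sum>b | b \<in> {1..m j} \<and> coprime b (m j).
     (cmod (\<Sum>n=M+1..M+N. a n * add_char (of_nat b * of_nat n / of_nat (m j))))\<^sup>2)"
  have q\<delta>: "?q powr \<delta> > 1" using Q \<delta> by simp
  have Z0: "?Z \<ge> 0" by (simp add: sum_nonneg)
  have c: "(?q powr \<delta>) ^ c j \<le> m j" "m j \<le> ?q powr \<delta> * (?q powr \<delta>) ^ c j"
    "c j \<le> C" if j: "j \<in> {1..Q}" for j
  proof -
    have mj: "real (m j) \<ge> 1" using pos[OF j] by simp
    then have log0: "log (?q powr \<delta>) (m j) \<ge> 0" using q\<delta> Q by simp
    then have 1: "real (c j) \<le> log (?q powr \<delta>) (m j)" "log (?q powr \<delta>) (m j) \<le> real (c j + 1)"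
      unfolding c_def by linarith+
    have "(?q powr \<delta>) ^ c j = (?q powr \<delta>) powr real (c j)" using q\<delta> Q by (intro powr_realpow[symmetric]) linarith
    also have "\<dots> \<le> (?q powr \<delta>) powr log (?q powr \<delta>) (m j)" using q\<delta> Q 1 by (intro powr_mono) auto
    also have "\<dots> = m j" using q\<delta> Q mj by (intro powr_log_cancel) auto
    finally show "(?q powr \<delta>) ^ c j \<le> m j" .
    have "real (m j) = (?q powr \<delta>) powr log (?q powr \<delta>) (m j)"
      using q\<delta> Q mj by (intro powr_log_cancel[symmetric]) auto
    also have "\<dots> \<le> (?q powr \<delta>) powr real (c j + 1)" using q\<delta> Q 1 by (intro powr_mono) auto
    also have "\<dots> = (?q powr \<delta>) ^ (c j + 1)" using q\<delta> Q by (intro powr_realpow) linarith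
    finally show "m j \<le> ?q powr \<delta> * (?q powr \<delta>) ^ c j" by simp
    have "log (?q powr \<delta>) (m j) \<le> log (?q powr \<delta>) (?q powr (\<alpha> + \<delta>))"
      using m[OF j] mj q\<delta> Q by (subst log_le_cancel_iff) auto
    also have "?q powr (\<alpha> + \<delta>) = (?q powr \<delta>) powr ((\<alpha> + \<delta>) / \<delta>)"
      using \<delta> by (simp add: powr_powr)
    also have "log (?q powr \<delta>) \<dots> = (\<alpha> + \<delta>) / \<delta>" using q\<delta> Q by (intro log_powr_cancel) auto
    finally show "c j \<le> C" unfolding c_def C_def by (intro nat_mono floor_mono)
  qed
  have R0: "R \<ge> 0" by (simp add: R_def)
  have block: "(\<Sum>j | j \<in> {1..Q} \<and> c j = i. g j) \<le> 144 * ?q powr (4 * \<delta>) * R * ?Z" for i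
  \<comment> \<open>An empty block is treated apart because the bound on \<open>U\<close> is read
    off from a member of the block.\<close>
  proof (cases "{j \<in> {1..Q}. c j = i} = {}")
    case True
    show ?thesis unfolding True using R0 Z0 by simp
  next
    case False
    then obtain j where j: "j \<in> {1..Q}" "c j = i" by auto
    define T where "T = (?q powr \<delta>) ^ i"
    define U where "U = ?q powr \<delta> * T"
    have T: "T > 0" using q\<delta> Q unfolding T_def by (intro zero_less_power) linarith
    have "T \<le> m j" using c(1)[OF j(1)] j(2) by (simp add: T_def)
    also have "\<dots> \<le> ?q powr (\<alpha> + \<delta>)" by (rule m[OF j(1)])
    finally have "U \<le> ?q powr \<delta> * ?q powr (\<alpha> + \<delta>)"
      unfolding U_def by (rule mult_left_mono) simp
    then have U: "U \<le> ?q powr (\<alpha> + 2 * \<delta>)" by (simp add: powr_add[symmetric] algebra_simps)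
    have "(\<Sum>j | j \<in> {1..Q} \<and> c j = i. g j) \<le> 16 * real N * ((2 * U / N + 1) *
        (real (fam_energy (\<lambda>j. real (m j)) {1..Q})
        + real (fam_energy_star (\<lambda>j. real (m j)) {1..Q}) * ((8 * U\<^sup>2 / N + 1) * (4 * U / T + 2))) powr (1/4)) * ?Z"
      unfolding g_def
    proof (rule sieve_block_le)
      show "U \<ge> 0" using T by (simp add: U_def)
      fix j assume "j \<in> {j. j \<in> {1..Q} \<and> c j = i}"
      then show "T \<le> m j" "m j \<le> U" using c[of j] by (auto simp: T_def U_def)
    qed (use T N in auto)
    also have "\<dots> \<le> 144 * ?q powr (4 * \<delta>) * R * ?Z"
      unfolding R_def using Q \<delta> T N U Z0
      by (intro mult_right_mono block_constant_le) (auto simp: U_def)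
    finally show ?thesis .
  qed
  have "sieve_sum m Q M N a = (\<Sum>j\<in>{1..Q}. g j)" by (simp add: sieve_sum_def g_def)
  also have "\<dots> = (\<Sum>i\<le>C. \<Sum>j | j \<in> {1..Q} \<and> c j = i. g j)"
    using c(3) by (intro sum.group[symmetric]) auto
  also have "\<dots> \<le> real (card {..C}) * (144 * ?q powr (4 * \<delta>) * R * ?Z)"
    using block by (intro sum_bounded_above)
  also have "\<dots> \<le> ((\<alpha> + \<delta>) / \<delta> + 1) * (144 * ?q powr (4 * \<delta>) * R * ?Z)"
  proof (rule mult_right_mono)
    have "(\<alpha> + \<delta>) / \<delta> \<ge> 0" using \<alpha> \<delta> by simp
    then show "real (card {..C}) \<le> (\<alpha> + \<delta>) / \<delta> + 1" unfolding C_def by simp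
  qed (use R0 Z0 in simp)
  finally show ?thesis .
qed

section \<open>Choice of the threshold and conclusion\<close>

theorem theorem1p1:
  fixes \<alpha> :: real and m :: "nat \<Rightarrow> nat"
  assumes "\<alpha> > 0"
    and "\<And>j. j \<ge> 1 \<Longrightarrow> m j > 0"
    and "\<exists>\<eta> :: nat \<Rightarrow> real. \<eta> \<longlonglongrightarrow> 0 \<and>
           (\<forall>\<^sub>F j in sequentially. real (m j) = real j powr (\<alpha> + \<eta> j))"
  shows "\<forall>\<epsilon>>0. \<exists>Q0. \<forall>Q\<ge>Q0. \<forall>(M::nat) (N::nat) (a :: nat \<Rightarrow> complex).
      Q \<ge> 1 \<longrightarrow> N \<ge> 1 \<longrightarrow> real Q powr \<alpha> \<le> real N \<longrightarrow> real N \<le> real Q powr (2 * \<alpha>) \<longrightarrow>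
        (inj_on m {1..Q} \<longrightarrow>
          sieve_sum m Q M N a
          \<le> (real N * real (energy ((\<lambda>j. real (m j)) ` {1..Q})) powr (1/4)
              + real N powr (3/4) * real Q powr (\<alpha>/2)
                * real (energy_star ((\<lambda>j. real (m j)) ` {1..Q})) powr (1/4))
            * real Q powr \<epsilon> * (\<Sum>n=M+1..M+N. (cmod (a n))\<^sup>2)) \<and>
        sieve_sum m Q M N a
          \<le> (real N * real (fam_energy (\<lambda>j. real (m j)) {1..Q}) powr (1/4)
              + real N powr (3/4) * real Q powr (\<alpha>/2)
                * real (fam_energy_star (\<lambda>j. real (m j)) {1..Q}) powr (1/4))
            * real Q powr \<epsilon> * (\<Sum>n=M+1..M+N. (cmod (a n))\<^sup>2)"
proof (intro allI impI, goal_cases)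
  case \<epsilon>: (1 \<epsilon>)
  \<comment> \<open>Four parts of \<open>\<epsilon>\<close> pay for the exponent
    \<open>4 * \<delta>\<close> in \<open>sieve_sum_le\<close>, the fifth for the constant
    \<open>c\<close>.\<close>
  define \<delta> where "\<delta> = \<epsilon> / 5"
  have \<delta>: "\<delta> > 0" using \<epsilon> by (simp add: \<delta>_def)
  from assms(3) obtain \<eta> :: "nat \<Rightarrow> real" where "\<eta> \<longlonglongrightarrow> 0"
    "\<forall>\<^sub>F j in sequentially. real (m j) = real j powr (\<alpha> + \<eta> j)" by blast
  from eventually_moduli_le[OF assms(1) \<delta> this]
  obtain Q1 where Q1: "\<And>Q j. Q \<ge> Q1 \<Longrightarrow> j \<in> {1..Q} \<Longrightarrow> real (m j) \<le> real Q powr (\<alpha> + \<delta>)"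
    by blast
  define c where "c = ((\<alpha> + \<delta>) / \<delta> + 1) * 144"
  have c0: "c \<ge> 0" using assms(1) \<delta> by (simp add: c_def)
  \<comment> \<open>The three thresholds ensure a logarithm base above 1, the bound on the moduli,
    and \<open>c \<le> Q powr \<delta>\<close>.\<close>
  define Q0 where "Q0 = max 2 (max Q1 (nat \<lceil>c powr (1 / \<delta>)\<rceil>))"
  have main: "sieve_sum m Q M N a
          \<le> (real N * real (fam_energy (\<lambda>j. real (m j)) {1..Q}) powr (1/4)
              + real N powr (3/4) * real Q powr (\<alpha>/2)
                * real (fam_energy_star (\<lambda>j. real (m j)) {1..Q}) powr (1/4))
            * real Q powr \<epsilon> * (\<Sum>n=M+1..M+N. (cmod (a n))\<^sup>2)" (is "_ \<le> ?R * _ * ?Z")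
    if Q: "Q \<ge> Q0" and N: "N \<ge> 1" "real Q powr \<alpha> \<le> real N" "real N \<le> real Q powr (2 * \<alpha>)"
    for Q M N a
  proof -
    have Q': "Q \<ge> 2" "Q \<ge> Q1" "c powr (1 / \<delta>) \<le> Q"
      using Q by (auto simp: Q0_def nat_le_iff ceiling_le_iff)
    have RZ: "?R * ?Z \<ge> 0" by (simp add: sum_nonneg)
    have "sieve_sum m Q M N a \<le> ((\<alpha> + \<delta>) / \<delta> + 1) * (144 * real Q powr (4 * \<delta>) * ?R * ?Z)"
      using Q' N \<delta> assms(1,2) Q1[OF Q'(2)] by (intro sieve_sum_le) auto
    also have "\<dots> = c * (real Q powr (4 * \<delta>) * (?R * ?Z))"
      by (simp only: c_def mult_ac)
    also have "\<dots> \<le> real Q powr \<delta> * (real Q powr (4 * \<delta>) * (?R * ?Z))"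
      using le_powr_of_powr_inverse_le[OF c0 \<delta> Q'(3)] RZ by (intro mult_right_mono) auto
    also have "\<dots> = (real Q powr \<delta> * real Q powr (4 * \<delta>)) * (?R * ?Z)"
      by (simp only: mult.assoc)
    also have "real Q powr \<delta> * real Q powr (4 * \<delta>) = real Q powr \<epsilon>"
      by (simp add: \<delta>_def flip: powr_add)
    finally show ?thesis by (simp only: mult_ac)
  qed
  show ?case
  proof (intro exI[of _ Q0] allI impI conjI)
    fix Q M N :: nat and a :: "nat \<Rightarrow> complex"
    assume Q: "Q \<ge> Q0" and N: "N \<ge> 1" "real Q powr \<alpha> \<le> real N" "real N \<le> real Q powr (2 * \<alpha>)"
      and "inj_on m {1..Q}"
    \<comment> \<open>For distinct moduli the energies of the family and of the set of values
      coincide, so the first claim reduces to \<open>main\<close>.\<close>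
    from this(5) have inj: "inj_on (\<lambda>j. real (m j)) {1..Q}" unfolding inj_on_def of_nat_eq_iff .
    show "sieve_sum m Q M N a
          \<le> (real N * real (energy ((\<lambda>j. real (m j)) ` {1..Q})) powr (1/4)
              + real N powr (3/4) * real Q powr (\<alpha>/2)
                * real (energy_star ((\<lambda>j. real (m j)) ` {1..Q})) powr (1/4))
            * real Q powr \<epsilon> * (\<Sum>n=M+1..M+N. (cmod (a n))\<^sup>2)"
      unfolding fam_energy_eq[OF inj, symmetric] fam_energy_star_eq[OF inj, symmetric]
      by (rule main[OF Q N])
  qed (rule main)
qed

end
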